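(* Let $T,\Lambda>0$ and $a\in C^{1}([0,T]\times[0,\Lambda])$. For $\lambda\in[0,\Lambda]$ let $\phi_1(t,\lambda),\phi_2(t,\lambda)$, $t\in[0,T]$, be the canonical solutions of $\ddot y+a(t,\lambda)y=0$, i.e. the solutions with $$\phi_1(0,\lambda)=\dot\phi_2(0,\lambda)=1,\qquad \dot\phi_1(0,\lambda)=\phi_2(0,\lambda)=0,$$ and define $$R_\lambda:=\sup_{\mu\in[0,\lambda]}\max\big\{\|\phi_i(\cdot,\mu)\|_\infty,\ \|\dot\phi_i(\cdot,\mu)\|_\infty : i=1,2\big\},$$ where $\|\cdot\|_\infty$ is the supremum norm on $[0,T]$. Let $r_0$ be a positive number greater than $R_0$. Assume: 1. There exists a positive continuous function $d=d(\lambda,R)$, defined for $\lambda\in[0,\Lambda]$ and $R\ge 0$, which is increasing in both variables and such that $$d(\lambda,R_\lambda)\ \ge\ \sup_{t\in[0,T]}|\partial_\lambda a(t,\lambda)|\qquad\text{for all }\lambda\in[0,\Lambda].$$ 2. There is $\lambda^*\in\,]0,\Lambda]$ such that for each $\lambda\in\,]0,\lambda^*]$ the function $Q(\lambda,\cdot)$ on $[0,\infty[$, where $$Q(\lambda,R)=2T\lambda R^{3}d(\lambda,R)-R+r_0,$$ has at least two consecutive zeros, and moreover, denoting by $R_{1,\lambda}<R_{2,\lambda}$ the first two consecutive zeros of $Q(\lambda,\cdot)$: (a) $r_0\le R_{1,\lambda}$ for all $\lambda\in\,]0,\lambda^*]$; (b) for all $\lambda\in\,]0,\lambda^*]$, $Q(\lambda,R)>0$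 for all $R\in[0,R_{1,\lambda}[$ and $Q(\lambda,R)<0$ for all $R\in\,]R_{1,\lambda},R_{2,\lambda}[$. Then $R_\lambda\le R_{1,\lambda}$ for all $\lambda\in\,]0,\lambda^*]$.
   Context: Dots denote derivatives with respect to $t$. The notation $]a,b]$, $[a,b[$, $]a,b[$ denotes half-open and open intervals. *)

theory Defs
  imports "HOL-Analysis.Analysis"
begin

(* Intended for sets such as closed boxes, where the derivative within S is unique;
   at boundary points it is the one-sided derivative. *)
definition C1_on :: "'a::real_normed_vector set \<Rightarrow> ('a \<Rightarrow> 'b::real_normed_vector) \<Rightarrow> bool"
  where "C1_on S f \<longleftrightarrow>
    (\<exists>D. (\<forall>x\<in>S. (f has_derivative blinfun_apply (D x)) (at x within S)) \<and> continuous_on S D)"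

(* Derivative of a function on the compact interval [0,b] (one-sided at 0 and b). *)
definition ivl_deriv :: "real \<Rightarrow> (real \<Rightarrow> real) \<Rightarrow> real \<Rightarrow> real"
  where "ivl_deriv b f x = vector_derivative f (at x within {0..b})"

definition solves_ivp ::
    "real \<Rightarrow> (real \<Rightarrow> real) \<Rightarrow> real \<Rightarrow> real \<Rightarrow> (real \<Rightarrow> real) \<Rightarrow> bool"
  where "solves_ivp T q y0 v0 y \<longleftrightarrow>
    (\<forall>t\<in>{0..T}. y differentiable (at t within {0..T})) \<and>
    (\<forall>t\<in>{0..T}. ivl_deriv T y differentiable (at t within {0..T})) \<and>
    (\<forall>t\<in>{0..T}. ivl_deriv T (ivl_deriv T y) t + q t * y t = 0) \<and>
    y 0 = y0 \<and> ivl_deriv T y 0 = v0"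

(* Real-valued suprema: this and Rsup are meaningful only for sets bounded above,
   which holds for continuous f and for the canonical solutions. *)
definition sup_norm :: "real \<Rightarrow> (real \<Rightarrow> real) \<Rightarrow> real"
  where "sup_norm T f = (SUP t\<in>{0..T}. \<bar>f t\<bar>)"

(* The functions phi take their arguments in the order (t, lambda). *)
definition Rsup ::
    "real \<Rightarrow> (real \<Rightarrow> real \<Rightarrow> real) \<Rightarrow> (real \<Rightarrow> real \<Rightarrow> real) \<Rightarrow> real \<Rightarrow> real"
  where "Rsup T \<phi>1 \<phi>2 l =
    (SUP \<mu>\<in>{0..l}. Max {sup_norm T (\<lambda>t. \<phi>1 t \<mu>), sup_norm T (ivl_deriv T (\<lambda>t. \<phi>1 t \<mu>)),
                         sup_norm T (\<lambda>t. \<phi>2 t \<mu>), sup_norm T (ivl_deriv T (\<lambda>t. \<phi>2 t \<mu>))})"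

definition Qfun :: "real \<Rightarrow> real \<Rightarrow> (real \<Rightarrow> real \<Rightarrow> real) \<Rightarrow> real \<Rightarrow> real \<Rightarrow> real"
  where "Qfun T r0 d l R = 2 * T * l * R ^ 3 * d l R - R + r0"

(* r is the smallest zero of f on [0,\<infinity>) and s the next one. *)
definition first_two_zeros :: "(real \<Rightarrow> real) \<Rightarrow> real \<Rightarrow> real \<Rightarrow> bool"
  where "first_two_zeros f r s \<longleftrightarrow>
    0 \<le> r \<and> r < s \<and> f r = 0 \<and> f s = 0 \<and> (\<forall>x\<in>{0..<s}. f x = 0 \<longrightarrow> x = r)"

end

(* The variation of constants formula, applied to the difference of solutions for the parameters mu
   and 0, gives R_l <= R_0 + 2 T l R_l^3 d(l, R_l), hence Q(l, R_l) > 0. Moreover R_l depends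
   continuously on l and starts below r0 <= R_{1,l0}. If R_{l0} > R_{1,l0}, then R_l = R_{1,l0} for
   some l < l0, and Q(l, R_l) <= Q(l0, R_{1,l0}) = 0 because Q(., R) is increasing: contradiction. *)
theory Submission
  imports Defs
begin

section \<open>Solutions as first-order systems, sup norms and the mean value inequality\<close>

lemma ivl_deriv_eqI:
  assumes "0 < b" "x \<in> {0..b}" "(f has_real_derivative D) (at x within {0..b})"
  shows "ivl_deriv b f x = D"
  using assms vector_derivative_within_closed_interval[of 0 b x f D]
  by (simp add: ivl_deriv_def has_real_derivative_iff_has_vector_derivative)

lemma differentiable_imp_has_ivl_deriv:
  assumes "f differentiable (at x within {0..b})"
  shows "(f has_real_derivative ivl_deriv b f x) (at x within {0..b})"
  using assms unfolding ivl_deriv_def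
  by (simp add: has_real_derivative_iff_has_vector_derivative vector_derivative_works)

text \<open>Rewrites the second-order equation as a first-order system for the pair of
  \<open>y\<close> and \<open>ivl_deriv T y\<close>, the form in which all later derivative
  computations use it.\<close>

lemma solves_ivp_deriv:
  assumes "solves_ivp T q y0 v0 y" "t \<in> {0..T}"
  shows "(y has_real_derivative ivl_deriv T y t) (at t within {0..T})"
    and "(ivl_deriv T y has_real_derivative - q t * y t) (at t within {0..T})"
proof -
  show "(y has_real_derivative ivl_deriv T y t) (at t within {0..T})"
    using assms by (intro differentiable_imp_has_ivl_deriv) (auto simp: solves_ivp_def)
  have "(ivl_deriv T y has_real_derivative ivl_deriv T (ivl_deriv T y) t) (at t within {0..T})"
    using assms by (intro differentiable_imp_has_ivl_deriv) (auto simp: solves_ivp_def)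
  moreover have "ivl_deriv T (ivl_deriv T y) t + q t * y t = 0"
    using assms by (auto simp: solves_ivp_def)
  then have "ivl_deriv T (ivl_deriv T y) t = - q t * y t"
    by simp
  ultimately show "(ivl_deriv T y has_real_derivative - q t * y t) (at t within {0..T})"
    by simp
qed

lemma solves_ivp_continuous:
  assumes "solves_ivp T q y0 v0 y"
  shows "continuous_on {0..T} y" "continuous_on {0..T} (ivl_deriv T y)"
  by (rule DERIV_continuous_on[OF solves_ivp_deriv(1)[OF assms]]
      DERIV_continuous_on[OF solves_ivp_deriv(2)[OF assms]], assumption)+

text \<open>A real-valued supremum dominates its elements only if the set is bounded above;
  continuity on the compact interval provides this.\<close>

lemma abs_le_sup_norm:
  assumes "continuous_on {0..T} f" "t \<in> {0..T}"
  shows "\<bar>f t\<bar> \<le> sup_norm T f"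
  unfolding sup_norm_def
proof (rule cSUP_upper)
  have "compact ((\<lambda>t. \<bar>f t\<bar>) ` {0..T})"
    using assms by (intro compact_continuous_image continuous_intros) auto
  then show "bdd_above ((\<lambda>t. \<bar>f t\<bar>) ` {0..T})"
    by (simp add: bounded_imp_bdd_above compact_imp_bounded)
qed (use assms in auto)

lemma sup_norm_le:
  assumes "0 \<le> T" "\<And>t. t \<in> {0..T} \<Longrightarrow> \<bar>f t\<bar> \<le> B"
  shows "sup_norm T f \<le> B"
  unfolding sup_norm_def using assms by (intro cSUP_least) auto

text \<open>Mean value inequality with one-sided derivatives at the endpoints. It is applied in the
  time variable and, with another interval length for \<open>T\<close>, in the parameter.\<close>

lemma real_derivative_abs_bound:
  fixes f f' :: "real \<Rightarrow> real"
  assumes "\<And>t. t \<in> {0..T} \<Longrightarrow> (f has_real_derivative f' t) (at t within {0..T})"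
    and "\<And>t. t \<in> {0..T} \<Longrightarrow> \<bar>f' t\<bar> \<le> B"
    and "s \<in> {0..T}" "t \<in> {0..T}"
  shows "\<bar>f t - f s\<bar> \<le> B * \<bar>t - s\<bar>"
  using field_differentiable_bound[of "{0..T}" f f' B t s] assms by auto

section \<open>Wronskian, variation of constants and a priori bounds\<close>

text \<open>The equation has no first-order term, so the derivative of the Wronskian vanishes: the
  products of first derivatives cancel, and so do the terms with \<open>q\<close>. The initial
  values give 1.\<close>

lemma wronskian_eq_1:
  assumes "solves_ivp T q 1 0 u" "solves_ivp T q 0 1 v" "t \<in> {0..T}"
  shows "u t * ivl_deriv T v t - ivl_deriv T u t * v t = 1"
proof -
  let ?W = "\<lambda>t. u t * ivl_deriv T v t - ivl_deriv T u t * v t"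
  have "(?W has_real_derivative 0) (at s within {0..T})" if "s \<in> {0..T}" for s
    by (rule DERIV_cong[OF DERIV_diff[OF
          DERIV_mult[OF solves_ivp_deriv(1)[OF assms(1) that] solves_ivp_deriv(2)[OF assms(2) that]]
          DERIV_mult[OF solves_ivp_deriv(2)[OF assms(1) that] solves_ivp_deriv(1)[OF assms(2) that]]]])
      (simp add: algebra_simps)
  then have "\<bar>?W t - ?W 0\<bar> \<le> 0 * \<bar>t - 0\<bar>"
    using assms(3) by (intro real_derivative_abs_bound[where f' = "\<lambda>_. 0" and T = T]) auto
  then show ?thesis
    using assms(1,2) by (simp add: solves_ivp_def)
qed

text \<open>The difference \<open>w = z - y\<close> has zero initial data and satisfies w'' + q w =
  -(p - q) z. Variation of constants writes it through the fundamental system \<open>u\<close>,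
  \<open>v\<close> of the equation with \<open>q\<close>. Each of the two terms contributes at most
  \<open>T * M\<^sup>2 * K * \<delta>\<close>: one factor \<open>M\<close> from the derivative of
  the coefficient, one from the function it multiplies.\<close>

lemma solution_diff_bound:
  assumes "T > 0"
    and u: "solves_ivp T q 1 0 u" and v: "solves_ivp T q 0 1 v"
    and y: "solves_ivp T q y0 v0 y" and z: "solves_ivp T p y0 v0 z"
    and M: "\<And>t. t \<in> {0..T} \<Longrightarrow> \<bar>u t\<bar> \<le> M" "\<And>t. t \<in> {0..T} \<Longrightarrow> \<bar>v t\<bar> \<le> M"
      "\<And>t. t \<in> {0..T} \<Longrightarrow> \<bar>ivl_deriv T u t\<bar> \<le> M" "\<And>t. t \<in> {0..T} \<Longrightarrow> \<bar>ivl_deriv T v t\<bar> \<le> M"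
    and K: "\<And>t. t \<in> {0..T} \<Longrightarrow> \<bar>z t\<bar> \<le> K"
    and \<delta>: "\<And>t. t \<in> {0..T} \<Longrightarrow> \<bar>p t - q t\<bar> \<le> \<delta>"
    and t: "t \<in> {0..T}"
  shows "\<bar>z t - y t\<bar> \<le> 2 * T * M\<^sup>2 * K * \<delta>"
    and "\<bar>ivl_deriv T z t - ivl_deriv T y t\<bar> \<le> 2 * T * M\<^sup>2 * K * \<delta>"
proof -
  define w where "w t = z t - y t" for t
  define w' where "w' t = ivl_deriv T z t - ivl_deriv T y t" for t
  have nonneg: "0 \<le> M" "0 \<le> K" "0 \<le> \<delta>"
    using M(1)[OF t] K[OF t] \<delta>[OF t] by linarith+
  have w: "(w has_real_derivative w' s) (at s within {0..T})"
    "(w' has_real_derivative (- q s * w s - (p s - q s) * z s)) (at s within {0..T})"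
    if "s \<in> {0..T}" for s
    unfolding w_def w'_def
    by (rule DERIV_diff[OF solves_ivp_deriv(1)[OF z that] solves_ivp_deriv(1)[OF y that]],
        rule DERIV_cong[OF DERIV_diff[OF solves_ivp_deriv(2)[OF z that] solves_ivp_deriv(2)[OF y that]]],
        simp add: algebra_simps)
  have w0: "w 0 = 0" "w' 0 = 0"
    using y z by (auto simp: w_def w'_def solves_ivp_def)
  (* The coefficients of w with respect to the fundamental system (u, v), obtained by Cramer's rule. *)
  define c1 where "c1 t = w t * ivl_deriv T v t - w' t * v t" for t
  define c2 where "c2 t = u t * w' t - ivl_deriv T u t * w t" for t
  \<comment> \<open>All terms with \<open>w\<close> and \<open>w'\<close> cancel, since
    \<open>u\<close>, \<open>v\<close> and the homogeneous part for \<open>w\<close> share the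
    coefficient \<open>q\<close>; only the source \<open>(p - q) * z\<close> survives.\<close>
  have c_deriv: "(c1 has_real_derivative (p s - q s) * z s * v s) (at s within {0..T})"
    "(c2 has_real_derivative - ((p s - q s) * z s * u s)) (at s within {0..T})"
    if "s \<in> {0..T}" for s
    unfolding c1_def c2_def
    by (rule DERIV_cong[OF DERIV_diff[OF
          DERIV_mult[OF w(1)[OF that] solves_ivp_deriv(2)[OF v that]]
          DERIV_mult[OF w(2)[OF that] solves_ivp_deriv(1)[OF v that]]]],
        simp add: algebra_simps,
        rule DERIV_cong[OF DERIV_diff[OF
          DERIV_mult[OF solves_ivp_deriv(1)[OF u that] w(2)[OF that]]
          DERIV_mult[OF solves_ivp_deriv(2)[OF u that] w(1)[OF that]]]],
        simp add: algebra_simps)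
  have c_deriv_bound: "\<bar>(p s - q s) * z s * v s\<bar> \<le> \<delta> * K * M" "\<bar>- ((p s - q s) * z s * u s)\<bar> \<le> \<delta> * K * M"
    if "s \<in> {0..T}" for s
    unfolding abs_mult abs_minus_cancel
    using M[OF that] K[OF that] \<delta>[OF that] nonneg by (auto intro!: mult_mono)
  have "\<bar>c1 t - c1 0\<bar> \<le> \<delta> * K * M * \<bar>t - 0\<bar>" "\<bar>c2 t - c2 0\<bar> \<le> \<delta> * K * M * \<bar>t - 0\<bar>"
    using t real_derivative_abs_bound[OF c_deriv(1) c_deriv_bound(1), of 0 t]
      real_derivative_abs_bound[OF c_deriv(2) c_deriv_bound(2), of 0 t] by auto
  moreover have "\<delta> * K * M * \<bar>t - 0\<bar> \<le> \<delta> * K * M * T"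
    using t nonneg by (intro mult_left_mono) auto
  ultimately have c: "\<bar>c1 t\<bar> \<le> \<delta> * K * M * T" "\<bar>c2 t\<bar> \<le> \<delta> * K * M * T"
    by (simp_all add: c1_def c2_def w0)
  \<comment> \<open>Stated for arbitrary \<open>A\<close>, \<open>B\<close> to cover both claims:
    the values of \<open>u\<close>, \<open>v\<close> give \<open>w\<close>, those of their
    derivatives give \<open>w'\<close>.\<close>
  have comb: "\<bar>c1 t * A + c2 t * B\<bar> \<le> 2 * T * M\<^sup>2 * K * \<delta>" if "\<bar>A\<bar> \<le> M" "\<bar>B\<bar> \<le> M" for A B
  proof -
    have "\<bar>c1 t * A\<bar> \<le> \<delta> * K * M * T * M" "\<bar>c2 t * B\<bar> \<le> \<delta> * K * M * T * M"
      unfolding abs_mult using c that nonneg \<open>T > 0\<close> by (simp_all add: mult_mono)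
    then have "\<bar>c1 t * A + c2 t * B\<bar> \<le> 2 * (\<delta> * K * M * T * M)"
      by linarith
    then show ?thesis
      by (simp add: power2_eq_square mult_ac)
  qed
  note W = wronskian_eq_1[OF u v t]
  \<comment> \<open>Multiplying by the Wronskian, which is 1, and regrouping recovers
    \<open>w\<close> and \<open>w'\<close> from the coefficients.\<close>
  have "w t = w t * (u t * ivl_deriv T v t - ivl_deriv T u t * v t)"
    "w' t = w' t * (u t * ivl_deriv T v t - ivl_deriv T u t * v t)"
    by (simp_all add: W)
  then have "w t = c1 t * u t + c2 t * v t"
    "w' t = c1 t * ivl_deriv T u t + c2 t * ivl_deriv T v t"
    by (simp_all add: c1_def c2_def algebra_simps)
  then show "\<bar>z t - y t\<bar> \<le> 2 * T * M\<^sup>2 * K * \<delta>"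
    "\<bar>ivl_deriv T z t - ivl_deriv T y t\<bar> \<le> 2 * T * M\<^sup>2 * K * \<delta>"
    using comb[OF M(1,2)[OF t]] comb[OF M(3,4)[OF t]] by (simp_all add: w_def w'_def)
qed

(* Gronwall's argument for the energy y^2 + y'^2. *)
lemma solution_bound:
  assumes y: "solves_ivp T q y0 v0 y"
    and A: "\<And>t. t \<in> {0..T} \<Longrightarrow> \<bar>q t\<bar> \<le> A"
    and init: "y0\<^sup>2 + v0\<^sup>2 \<le> 1"
    and t: "t \<in> {0..T}"
  shows "\<bar>y t\<bar> \<le> exp ((1 + A) * T)" "\<bar>ivl_deriv T y t\<bar> \<le> exp ((1 + A) * T)"
proof -
  let ?y' = "ivl_deriv T y"
  \<comment> \<open>The rate \<open>1 + A\<close> of the weight makes \<open>E\<close>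
    nonincreasing: the energy has derivative 2 y y' (1 - q), at most \<open>1 + A\<close> times the
    energy.\<close>
  define E where "E s = exp (- (1 + A) * s) * ((y s)\<^sup>2 + (?y' s)\<^sup>2)" for s
  define E' where "E' s = exp (- (1 + A) * s) *
    (2 * y s * ?y' s * (1 - q s) - (1 + A) * ((y s)\<^sup>2 + (?y' s)\<^sup>2))" for s
  have A0: "0 \<le> A" using A[OF t] by linarith
  have E: "(E has_real_derivative E' s) (at s within {0..T})" if "s \<in> {0..T}" for s
    unfolding E_def E'_def using solves_ivp_deriv[OF y that]
    by (auto intro!: derivative_eq_intros simp: algebra_simps power2_eq_square)
  have E'_le: "E' s \<le> 0" if "s \<in> {0..T}" for s
  proof -
    have "\<bar>2 * y s * ?y' s\<bar> \<le> (y s)\<^sup>2 + (?y' s)\<^sup>2"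
      using sum_squares_bound[of "\<bar>y s\<bar>" "\<bar>?y' s\<bar>"] by (simp add: abs_mult)
    moreover have "\<bar>1 - q s\<bar> \<le> 1 + A"
      using A[OF that] by linarith
    ultimately have "\<bar>2 * y s * ?y' s * (1 - q s)\<bar> \<le> ((y s)\<^sup>2 + (?y' s)\<^sup>2) * (1 + A)"
      unfolding abs_mult[of _ "1 - q s"] by (intro mult_mono) auto
    then have "2 * y s * ?y' s * (1 - q s) \<le> (1 + A) * ((y s)\<^sup>2 + (?y' s)\<^sup>2)"
      by (simp add: algebra_simps)
    then show ?thesis
      unfolding E'_def by (intro mult_nonneg_nonpos) auto
  qed
  have "E t \<le> E 0"
  proof -
    have "\<exists>s\<in>{0..t}. E t - E 0 = (\<lambda>h. E' s * h) (t - 0)"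
    proof (rule mvt_very_simple)
      fix s assume "0 \<le> s" "s \<le> t"
      then have "(E has_real_derivative E' s) (at s within {0..t})"
        using t by (intro DERIV_subset[OF E]) auto
      then show "(E has_derivative (\<lambda>h. E' s * h)) (at s within {0..t})"
        by (simp add: has_field_derivative_def)
    qed (use t in simp)
    then obtain s where s: "s \<in> {0..t}" "E t - E 0 = E' s * t"
      by auto
    then have "E' s * t \<le> 0"
      using t E'_le[of s] by (intro mult_nonpos_nonneg) auto
    then show ?thesis
      using s by simp
  qed
  also have "E 0 \<le> 1"
    using y init by (simp add: E_def solves_ivp_def)
  finally have "exp ((1 + A) * t) * E t \<le> exp ((1 + A) * t)"
    by simp
  moreover have "exp ((1 + A) * t) * E t =
      exp ((1 + A) * t) * exp (- ((1 + A) * t)) * ((y t)\<^sup>2 + (?y' t)\<^sup>2)"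
    by (simp only: E_def mult.assoc mult_minus_left)
  ultimately have "(y t)\<^sup>2 + (?y' t)\<^sup>2 \<le> exp ((1 + A) * t)"
    by (simp only: exp_minus_inverse mult_1_left)
  also have "\<dots> \<le> exp ((1 + A) * T)"
    using t A0 by (auto intro!: mult_left_mono)
  \<comment> \<open>The exponential is at least 1, so it is bounded by its own square; both sides
    are then squares and the bound passes to absolute values.\<close>
  also have "\<dots> \<le> (exp ((1 + A) * T))\<^sup>2"
    using t A0 by (intro self_le_power) auto
  finally have "(y t)\<^sup>2 + (?y' t)\<^sup>2 \<le> (exp ((1 + A) * T))\<^sup>2" .
  then have "(y t)\<^sup>2 \<le> (exp ((1 + A) * T))\<^sup>2" "(?y' t)\<^sup>2 \<le> (exp ((1 + A) * T))\<^sup>2"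
    using zero_le_power2[of "y t"] zero_le_power2[of "?y' t"] by linarith+
  then show "\<bar>y t\<bar> \<le> exp ((1 + A) * T)" "\<bar>?y' t\<bar> \<le> exp ((1 + A) * T)"
    by (simp_all flip: abs_le_square_iff)
qed

section \<open>Comparison of the fundamental systems of two equations\<close>

text \<open>The contribution of a single parameter value to \<open>Rsup\<close>, isolated so that
  two parameter values can be compared.\<close>

definition fund_norm :: "real \<Rightarrow> (real \<Rightarrow> real) \<Rightarrow> (real \<Rightarrow> real) \<Rightarrow> real"
  where "fund_norm T u v = Max {sup_norm T u, sup_norm T (ivl_deriv T u),
                                sup_norm T v, sup_norm T (ivl_deriv T v)}"

lemma Rsup_eq: "Rsup T \<phi>1 \<phi>2 l = (SUP \<mu>\<in>{0..l}. fund_norm T (\<lambda>t. \<phi>1 t \<mu>) (\<lambda>t. \<phi>2 t \<mu>))"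
  by (simp add: Rsup_def fund_norm_def)

lemma abs_le_fund_norm:
  assumes "solves_ivp T q 1 0 u" "solves_ivp T q 0 1 v" "t \<in> {0..T}"
  shows "\<bar>u t\<bar> \<le> fund_norm T u v" "\<bar>v t\<bar> \<le> fund_norm T u v"
    "\<bar>ivl_deriv T u t\<bar> \<le> fund_norm T u v" "\<bar>ivl_deriv T v t\<bar> \<le> fund_norm T u v"
proof -
  note b = abs_le_sup_norm[OF _ assms(3)]
  note c = solves_ivp_continuous[OF assms(1)] solves_ivp_continuous[OF assms(2)]
  show "\<bar>u t\<bar> \<le> fund_norm T u v" "\<bar>v t\<bar> \<le> fund_norm T u v"
    "\<bar>ivl_deriv T u t\<bar> \<le> fund_norm T u v" "\<bar>ivl_deriv T v t\<bar> \<le> fund_norm T u v"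
    using b[OF c(1)] b[OF c(2)] b[OF c(3)] b[OF c(4)] unfolding fund_norm_def by auto
qed

lemma fund_norm_le:
  assumes "0 \<le> T"
    and "\<And>t. t \<in> {0..T} \<Longrightarrow> \<bar>u t\<bar> \<le> B" "\<And>t. t \<in> {0..T} \<Longrightarrow> \<bar>v t\<bar> \<le> B"
      "\<And>t. t \<in> {0..T} \<Longrightarrow> \<bar>ivl_deriv T u t\<bar> \<le> B" "\<And>t. t \<in> {0..T} \<Longrightarrow> \<bar>ivl_deriv T v t\<bar> \<le> B"
  shows "fund_norm T u v \<le> B"
  unfolding fund_norm_def using assms by (auto intro!: sup_norm_le)

text \<open>Variation of constants with the common bound \<open>R\<close> for both systems. In
  \<open>R ^ 3\<close>, two factors come from the fundamental system \<open>u\<close>,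
  \<open>v\<close> and one from the solution \<open>\<xi>\<close> or \<open>\<eta>\<close> in the
  source term.\<close>

lemma fund_norm_diff_bound:
  assumes "T > 0"
    and "solves_ivp T q 1 0 u" "solves_ivp T q 0 1 v"
    and "solves_ivp T p 1 0 \<xi>" "solves_ivp T p 0 1 \<eta>"
    and R: "fund_norm T u v \<le> R" "fund_norm T \<xi> \<eta> \<le> R"
    and \<delta>: "\<And>t. t \<in> {0..T} \<Longrightarrow> \<bar>p t - q t\<bar> \<le> \<delta>"
  shows "fund_norm T u v \<le> fund_norm T \<xi> \<eta> + 2 * T * R ^ 3 * \<delta>"
proof -
  have b: "\<bar>u t\<bar> \<le> R" "\<bar>v t\<bar> \<le> R" "\<bar>ivl_deriv T u t\<bar> \<le> R" "\<bar>ivl_deriv T v t\<bar> \<le> R"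
    "\<bar>\<xi> t\<bar> \<le> R" "\<bar>\<eta> t\<bar> \<le> R"
    if "t \<in> {0..T}" for t
    by (rule order_trans[OF _ R(1)] order_trans[OF _ R(2)],
        rule abs_le_fund_norm[OF assms(2,3) that] abs_le_fund_norm[OF assms(4,5) that])+
  have R3: "2 * T * R ^ 3 * \<delta> = 2 * T * R\<^sup>2 * R * \<delta>"
    by (simp add: power2_eq_square power3_eq_cube)
  have d: "\<bar>\<xi> t - u t\<bar> \<le> 2 * T * R ^ 3 * \<delta>"
    "\<bar>ivl_deriv T \<xi> t - ivl_deriv T u t\<bar> \<le> 2 * T * R ^ 3 * \<delta>"
    "\<bar>\<eta> t - v t\<bar> \<le> 2 * T * R ^ 3 * \<delta>"
    "\<bar>ivl_deriv T \<eta> t - ivl_deriv T v t\<bar> \<le> 2 * T * R ^ 3 * \<delta>"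
    if "t \<in> {0..T}" for t
  proof -
    \<comment> \<open>The pair \<open>u\<close>, \<open>v\<close> serves as fundamental system in
      both instances; the solution compared is first \<open>u\<close> with \<open>\<xi>\<close>,
      then \<open>v\<close> with \<open>\<eta>\<close>.\<close>
    note u = solution_diff_bound[OF assms(1,2,3,2,4), of R R \<delta>]
    note v = solution_diff_bound[OF assms(1,2,3,3,5), of R R \<delta>]
    show "\<bar>\<xi> t - u t\<bar> \<le> 2 * T * R ^ 3 * \<delta>"
      unfolding R3 by (rule u(1)) (simp_all only: b \<delta> that)
    show "\<bar>ivl_deriv T \<xi> t - ivl_deriv T u t\<bar> \<le> 2 * T * R ^ 3 * \<delta>"
      unfolding R3 by (rule u(2)) (simp_all only: b \<delta> that)
    show "\<bar>\<eta> t - v t\<bar> \<le> 2 * T * R ^ 3 * \<delta>"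
      unfolding R3 by (rule v(1)) (simp_all only: b \<delta> that)
    show "\<bar>ivl_deriv T \<eta> t - ivl_deriv T v t\<bar> \<le> 2 * T * R ^ 3 * \<delta>"
      unfolding R3 by (rule v(2)) (simp_all only: b \<delta> that)
  qed
  show ?thesis
  proof (rule fund_norm_le)
    fix t assume t: "t \<in> {0..T}"
    note 1 = abs_le_fund_norm[OF assms(4,5) t] and 2 = d[OF t]
    show "\<bar>u t\<bar> \<le> fund_norm T \<xi> \<eta> + 2 * T * R ^ 3 * \<delta>"
      using 1(1) 2(1) by linarith
    show "\<bar>v t\<bar> \<le> fund_norm T \<xi> \<eta> + 2 * T * R ^ 3 * \<delta>"
      using 1(2) 2(3) by linarith
    show "\<bar>ivl_deriv T u t\<bar> \<le> fund_norm T \<xi> \<eta> + 2 * T * R ^ 3 * \<delta>"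
      using 1(3) 2(2) by linarith
    show "\<bar>ivl_deriv T v t\<bar> \<le> fund_norm T \<xi> \<eta> + 2 * T * R ^ 3 * \<delta>"
      using 1(4) 2(4) by linarith
  qed (use \<open>T > 0\<close> in simp)
qed

section \<open>Regularity in the parameter: running suprema and the partial derivative of the
  coefficient\<close>

text \<open>When the right endpoint grows from \<open>x\<close> to \<open>y\<close>, each
  \<open>\<mu>\<close> in the larger interval is compared with its projection
  \<open>min \<mu> x\<close> onto the smaller one, at distance at most \<open>y - x\<close>. This
  yields the continuity of \<open>Rsup\<close> in the parameter.\<close>

lemma running_sup_Lipschitz:
  fixes N :: "real \<Rightarrow> real"
  assumes "C-lipschitz_on {0..b} N"
  shows "C-lipschitz_on {0..b} (\<lambda>l. SUP \<mu>\<in>{0..l}. N \<mu>)"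
proof (rule lipschitz_on_leI)
  have bdd: "bdd_above (N ` {0..l})" if "l \<in> {0..b}" for l
  proof -
    have "continuous_on {0..l} N"
      using that by (intro continuous_on_subset[OF lipschitz_on_continuous_on[OF assms]]) auto
    then show ?thesis
      by (intro bounded_imp_bdd_above compact_imp_bounded compact_continuous_image) auto
  qed
  fix x y assume xy: "x \<in> {0..b}" "y \<in> {0..b}" "x \<le> y"
  have C: "0 \<le> C" using assms by (rule lipschitz_on_nonneg)
  have "(SUP \<mu>\<in>{0..x}. N \<mu>) \<le> (SUP \<mu>\<in>{0..y}. N \<mu>)"
    using xy by (intro cSUP_subset_mono bdd) auto
  moreover have "(SUP \<mu>\<in>{0..y}. N \<mu>) \<le> (SUP \<mu>\<in>{0..x}. N \<mu>) + C * (y - x)"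
  proof (rule cSUP_least)
    fix \<mu> assume \<mu>: "\<mu> \<in> {0..y}"
    have "N \<mu> \<le> N (min \<mu> x) + C * dist \<mu> (min \<mu> x)"
      using lipschitz_onD[OF assms, of \<mu> "min \<mu> x"] \<mu> xy by (simp add: dist_real_def min_le_iff_disj)
    also have "N (min \<mu> x) \<le> (SUP \<mu>\<in>{0..x}. N \<mu>)"
      using \<mu> xy by (intro cSUP_upper bdd) auto
    also have "C * dist \<mu> (min \<mu> x) \<le> C * (y - x)"
      using \<mu> xy C by (intro mult_left_mono) (auto simp: dist_real_def)
    finally show "N \<mu> \<le> (SUP \<mu>\<in>{0..x}. N \<mu>) + C * (y - x)" by simp
  qed (use xy in auto)
  ultimately show "dist (SUP \<mu>\<in>{0..x}. N \<mu>) (SUP \<mu>\<in>{0..y}. N \<mu>) \<le> C * dist x y"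
    using xy by (simp add: dist_real_def)
qed (rule lipschitz_on_nonneg[OF assms])

text \<open>The partial derivative in the parameter is the total derivative applied to
  \<open>(0, 1)\<close>, by the chain rule along a vertical segment of the rectangle; it inherits
  continuity from the total derivative.\<close>

lemma C1_on_rectangle_partial:
  fixes a :: "real \<Rightarrow> real \<Rightarrow> real"
  assumes "T > 0" "\<Lambda> > 0" and C1: "C1_on ({0..T} \<times> {0..\<Lambda>}) (\<lambda>(t, l). a t l)"
  shows "continuous_on ({0..T} \<times> {0..\<Lambda>}) (\<lambda>(t, l). a t l)"
    and "continuous_on ({0..T} \<times> {0..\<Lambda>}) (\<lambda>(t, l). ivl_deriv \<Lambda> (a t) l)"
    and "\<And>t l. t \<in> {0..T} \<Longrightarrow> l \<in> {0..\<Lambda>} \<Longrightarrow>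
      (a t has_real_derivative ivl_deriv \<Lambda> (a t) l) (at l within {0..\<Lambda>})"
proof -
  let ?S = "{0..T} \<times> {0..\<Lambda>}"
  from C1 obtain D :: "real \<times> real \<Rightarrow> (real \<times> real) \<Rightarrow>\<^sub>L real"
    where D: "\<And>x. x \<in> ?S \<Longrightarrow> ((\<lambda>(t, l). a t l) has_derivative blinfun_apply (D x)) (at x within ?S)"
    and contD: "continuous_on ?S D"
    unfolding C1_on_def by blast
  show "continuous_on ?S (\<lambda>(t, l). a t l)"
    using D by (rule has_derivative_continuous_on)
  have der: "(a t has_real_derivative blinfun_apply (D (t, l)) (0, 1)) (at l within {0..\<Lambda>})"
    if "t \<in> {0..T}" "l \<in> {0..\<Lambda>}" for t l
  proof -
    have "((\<lambda>s. (t, s)) has_derivative (\<lambda>h. (0, h))) (at l within {0..\<Lambda>})"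
      by (auto intro!: derivative_eq_intros)
    moreover have "((\<lambda>(t, l). a t l) has_derivative blinfun_apply (D (t, l)))
        (at (t, l) within (\<lambda>s. (t, s)) ` {0..\<Lambda>})"
      using that by (intro has_derivative_subset[OF D]) auto
    ultimately have "((\<lambda>(t, l). a t l) \<circ> (\<lambda>s. (t, s)) has_derivative blinfun_apply (D (t, l)) \<circ> (\<lambda>h. (0, h)))
        (at l within {0..\<Lambda>})"
      by (rule diff_chain_within)
    moreover have "blinfun_apply (D (t, l)) \<circ> (\<lambda>h. (0, h)) = (*) (blinfun_apply (D (t, l)) (0, 1))"
    proof
      fix h :: real
      show "(blinfun_apply (D (t, l)) \<circ> (\<lambda>h. (0, h))) h = blinfun_apply (D (t, l)) (0, 1) * h"
        using blinfun.scaleR_right[of "D (t, l)" h "(0, 1)"] by (simp add: mult.commute)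
    qed
    ultimately show ?thesis
      by (simp add: has_field_derivative_def o_def)
  qed
  then have eq: "ivl_deriv \<Lambda> (a t) l = blinfun_apply (D (t, l)) (0, 1)"
    if "t \<in> {0..T}" "l \<in> {0..\<Lambda>}" for t l
    using that \<open>\<Lambda> > 0\<close> by (intro ivl_deriv_eqI) auto
  show "(a t has_real_derivative ivl_deriv \<Lambda> (a t) l) (at l within {0..\<Lambda>})"
    if "t \<in> {0..T}" "l \<in> {0..\<Lambda>}" for t l
    using der[OF that] eq[OF that] by simp
  have "continuous_on ?S (\<lambda>x. blinfun_apply (D x) (0, 1))"
    by (intro continuous_intros contD)
  then show "continuous_on ?S (\<lambda>(t, l). ivl_deriv \<Lambda> (a t) l)"
    by (rule continuous_on_eq) (auto simp: eq)
qed

lemma continuous_on_rectangle_bounded: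
  fixes f :: "real \<Rightarrow> real \<Rightarrow> real"
  assumes "continuous_on ({0..T} \<times> {0..\<Lambda>}) (\<lambda>(t, l). f t l)"
  obtains B where "\<And>t l. t \<in> {0..T} \<Longrightarrow> l \<in> {0..\<Lambda>} \<Longrightarrow> \<bar>f t l\<bar> \<le> B"
proof -
  have "bounded ((\<lambda>(t, l). f t l) ` ({0..T} \<times> {0..\<Lambda>}))"
    using assms by (intro compact_imp_bounded compact_continuous_image compact_Times) auto
  then show ?thesis
    using that unfolding bounded_iff by fastforce
qed

section \<open>Growth estimate for \<open>Rsup\<close> and the intermediate value argument\<close>

theorem lemma1:
  fixes T \<Lambda> r0 lam_star :: real
    and a \<phi>1 \<phi>2 d :: "real \<Rightarrow> real \<Rightarrow> real"
    and R1 R2 :: "real \<Rightarrow> real"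
  assumes "T > 0" and "\<Lambda> > 0"
    and "C1_on ({0..T} \<times> {0..\<Lambda>}) (\<lambda>(t, l). a t l)"
    and "\<And>l. l \<in> {0..\<Lambda>} \<Longrightarrow> solves_ivp T (\<lambda>t. a t l) 1 0 (\<lambda>t. \<phi>1 t l)"
    and "\<And>l. l \<in> {0..\<Lambda>} \<Longrightarrow> solves_ivp T (\<lambda>t. a t l) 0 1 (\<lambda>t. \<phi>2 t l)"
    and "r0 > 0" and "r0 > Rsup T \<phi>1 \<phi>2 0"
    and "\<And>l R. l \<in> {0..\<Lambda>} \<Longrightarrow> R \<ge> 0 \<Longrightarrow> d l R > 0"
    and "continuous_on ({0..\<Lambda>} \<times> {0..}) (\<lambda>(l, R). d l R)"
    and "\<And>R. R \<ge> 0 \<Longrightarrow> mono_on {0..\<Lambda>} (\<lambda>l. d l R)"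
    and "\<And>l. l \<in> {0..\<Lambda>} \<Longrightarrow> mono_on {0..} (d l)"
    and "\<And>l. l \<in> {0..\<Lambda>} \<Longrightarrow>
           d l (Rsup T \<phi>1 \<phi>2 l) \<ge> (SUP t\<in>{0..T}. \<bar>ivl_deriv \<Lambda> (a t) l\<bar>)"
    and "lam_star \<in> {0<..\<Lambda>}"
    and "\<And>l. l \<in> {0<..lam_star} \<Longrightarrow> first_two_zeros (Qfun T r0 d l) (R1 l) (R2 l)"
    and "\<And>l. l \<in> {0<..lam_star} \<Longrightarrow> r0 \<le> R1 l"
    and "\<And>l R. l \<in> {0<..lam_star} \<Longrightarrow> R \<in> {0..<R1 l} \<Longrightarrow> Qfun T r0 d l R > 0"
    and "\<And>l R. l \<in> {0<..lam_star} \<Longrightarrow> R \<in> {R1 l<..<R2 l} \<Longrightarrow> Qfun T r0 d l R < 0"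
  shows "\<forall>l\<in>{0<..lam_star}. Rsup T \<phi>1 \<phi>2 l \<le> R1 l"
proof
  note T = assms(1) and sol1 = assms(4) and sol2 = assms(5)
  note partial = C1_on_rectangle_partial[OF assms(1,2,3)]
  define N where "N \<mu> = fund_norm T (\<lambda>t. \<phi>1 t \<mu>) (\<lambda>t. \<phi>2 t \<mu>)" for \<mu>
  define R where "R = Rsup T \<phi>1 \<phi>2"
  have R_eq: "R l = (SUP \<mu>\<in>{0..l}. N \<mu>)" for l
    by (simp add: R_def N_def Rsup_eq)
  obtain A where A: "\<And>t l. t \<in> {0..T} \<Longrightarrow> l \<in> {0..\<Lambda>} \<Longrightarrow> \<bar>a t l\<bar> \<le> A"
    using continuous_on_rectangle_bounded[OF partial(1)] by blast
  obtain L where L: "\<And>t l. t \<in> {0..T} \<Longrightarrow> l \<in> {0..\<Lambda>} \<Longrightarrow> \<bar>ivl_deriv \<Lambda> (a t) l\<bar> \<le> L"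
    using continuous_on_rectangle_bounded[OF partial(2)] by blast
  \<comment> \<open>A crude bound, uniform in the parameter. It gives bounded suprema and a
    Lipschitz constant for \<open>N\<close>; the quantitative estimate \<open>R_bound\<close> uses
    \<open>R l\<close> in its place.\<close>
  define K where "K = exp ((1 + A) * T)"
  have K: "N \<mu> \<le> K" if "\<mu> \<in> {0..\<Lambda>}" for \<mu>
    unfolding N_def K_def
    using T solution_bound[OF sol1[OF that] A[OF _ that]] solution_bound[OF sol2[OF that] A[OF _ that]]
    by (intro fund_norm_le) auto
  have N_nonneg: "0 \<le> N \<mu>" if "\<mu> \<in> {0..\<Lambda>}" for \<mu>
    using abs_le_fund_norm(1)[OF sol1[OF that] sol2[OF that], of 0] T unfolding N_def by force
  have L0: "0 \<le> L"
    using L[of 0 0] assms(1,2) by force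
  have N_diff: "N \<mu> \<le> N \<nu> + 2 * T * K ^ 3 * (L * \<bar>\<mu> - \<nu>\<bar>)" if "\<mu> \<in> {0..\<Lambda>}" "\<nu> \<in> {0..\<Lambda>}" for \<mu> \<nu>
    unfolding N_def
  proof (rule fund_norm_diff_bound[OF T sol1[OF that(1)] sol2[OF that(1)] sol1[OF that(2)] sol2[OF that(2)]])
    show "\<bar>a t \<nu> - a t \<mu>\<bar> \<le> L * \<bar>\<mu> - \<nu>\<bar>" if "t \<in> {0..T}" for t
      using real_derivative_abs_bound[OF partial(3)[OF that] L[OF that], of \<nu> \<mu>] \<open>\<mu> \<in> _\<close> \<open>\<nu> \<in> _\<close>
      by (simp add: abs_minus_commute)
  qed (use K that in \<open>auto simp: N_def\<close>)
  have "(2 * T * K ^ 3 * L)-lipschitz_on {0..\<Lambda>} N"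
  proof (rule lipschitz_onI)
    fix \<mu> \<nu> assume *: "\<mu> \<in> {0..\<Lambda>}" "\<nu> \<in> {0..\<Lambda>}"
    show "dist (N \<mu>) (N \<nu>) \<le> 2 * T * K ^ 3 * L * dist \<mu> \<nu>"
      using N_diff[OF *] N_diff[OF *(2,1)]
      by (simp add: dist_real_def abs_le_iff abs_minus_commute algebra_simps)
  qed (use T L0 in \<open>simp add: K_def\<close>)
  from lipschitz_on_continuous_on[OF running_sup_Lipschitz[OF this]]
  have contR: "continuous_on {0..\<Lambda>} R"
    by (simp add: R_eq[abs_def])
  have bddN: "bdd_above (N ` {0..l})" if "l \<in> {0..\<Lambda>}" for l
    using that by (intro bdd_aboveI[of _ K]) (auto intro: K)
  have N_le_R: "N \<mu> \<le> R l" if "\<mu> \<in> {0..l}" "l \<in> {0..\<Lambda>}" for \<mu> l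
    unfolding R_eq using that by (intro cSUP_upper bddN) auto
  have R_mono: "R m \<le> R l" if "m \<in> {0..l}" "l \<in> {0..\<Lambda>}" for m l
    unfolding R_eq using that by (intro cSUP_subset_mono bddN) auto
  have R_nonneg: "0 \<le> R l" if "l \<in> {0..\<Lambda>}" for l
    using N_nonneg[of l] N_le_R[of l l] that by force
  \<comment> \<open>The hypothesis on \<open>d\<close> bounds the derivative at \<open>m\<close> by
    \<open>d m (R m)\<close>. Monotonicity of \<open>R\<close> and of \<open>d\<close> in both
    variables turns this into one bound for all \<open>m\<close> in \<open>{0..l}\<close>.\<close>
  have da: "\<bar>ivl_deriv \<Lambda> (a t) m\<bar> \<le> d l (R l)" if "t \<in> {0..T}" "m \<in> {0..l}" "l \<in> {0..\<Lambda>}" for t m l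
  proof -
    have m: "m \<in> {0..\<Lambda>}" using that by auto
    have "\<bar>ivl_deriv \<Lambda> (a t) m\<bar> \<le> (SUP t\<in>{0..T}. \<bar>ivl_deriv \<Lambda> (a t) m\<bar>)"
      using that(1) L[OF _ m] by (intro cSUP_upper bdd_aboveI[of _ L]) auto
    also have "\<dots> \<le> d m (R m)"
      unfolding R_def by (rule assms(12)[OF m])
    also have "\<dots> \<le> d m (R l)"
      using R_mono R_nonneg m that by (intro mono_onD[OF assms(11)[OF m]]) auto
    also have "\<dots> \<le> d l (R l)"
      using m that R_nonneg by (intro mono_onD[OF assms(10)]) auto
    finally show ?thesis .
  qed
  have R_bound: "R l \<le> R 0 + 2 * T * l * R l ^ 3 * d l (R l)" if l: "l \<in> {0..\<Lambda>}" for l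
    unfolding R_eq[of l]
  proof (rule cSUP_least, goal_cases)
    case (2 \<mu>)
    have \<mu>: "\<mu> \<in> {0..\<Lambda>}" and zero: "0 \<in> {0..\<Lambda>}" using 2 l by auto
    \<comment> \<open>Comparison with parameter 0: both \<open>N \<mu>\<close> and
      \<open>N 0\<close> are at most \<open>R l\<close>, and the coefficients differ by at most
      \<open>d l (R l) * l\<close> by the mean value inequality on \<open>{0..l}\<close>.\<close>
    have "N \<mu> \<le> N 0 + 2 * T * R l ^ 3 * (d l (R l) * l)"
      unfolding N_def
    proof (rule fund_norm_diff_bound[OF T sol1[OF \<mu>] sol2[OF \<mu>] sol1[OF zero] sol2[OF zero]])
      fix t assume t: "t \<in> {0..T}"
      have "(a t has_real_derivative ivl_deriv \<Lambda> (a t) s) (at s within {0..l})" if "s \<in> {0..l}" for s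
        using that l by (intro DERIV_subset[OF partial(3)[OF t]]) auto
      from real_derivative_abs_bound[OF this da[OF t _ l], of \<mu> 0]
      have "\<bar>a t 0 - a t \<mu>\<bar> \<le> d l (R l) * \<mu>"
        using 2 l by simp
      also have "\<dots> \<le> d l (R l) * l"
        using 2 l assms(8)[OF l R_nonneg[OF l]] by (intro mult_left_mono) auto
      finally show "\<bar>a t 0 - a t \<mu>\<bar> \<le> d l (R l) * l" .
    qed (use N_le_R[of _ l] 2 l in \<open>auto simp: N_def\<close>)
    then show ?case
      using N_le_R[of 0 0] zero by (simp add: R_eq[symmetric] algebra_simps)
  qed (use l in auto)
  fix l0 assume l0: "l0 \<in> {0<..lam_star}"
  show "Rsup T \<phi>1 \<phi>2 l0 \<le> R1 l0"
  proof (rule ccontr)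
    assume "\<not> Rsup T \<phi>1 \<phi>2 l0 \<le> R1 l0"
    then have "R1 l0 \<le> R l0" by (simp add: R_def)
    moreover have "R 0 \<le> R1 l0"
      using assms(7) assms(15)[OF l0] by (simp add: R_def)
    moreover have "continuous_on {0..l0} R"
      using l0 assms(13) by (intro continuous_on_subset[OF contR]) auto
    \<comment> \<open>\<open>R\<close> starts at or below \<open>R1 l0\<close> and ends at or above
      it, so by continuity it takes this value at some parameter in between.\<close>
    ultimately obtain l where l: "0 \<le> l" "l \<le> l0" "R l = R1 l0"
      using IVT'[of R 0 "R1 l0" l0] l0 by auto
    have mem: "l \<in> {0..\<Lambda>}" "l0 \<in> {0..\<Lambda>}"
      using l l0 assms(13) by auto
    \<comment> \<open>By \<open>R_bound\<close> the value is at least \<open>r0 - R 0\<close>, which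
      is positive; this holds for \<open>l = 0\<close> as well.\<close>
    have "0 < Qfun T r0 d l (R l)"
      using R_bound[OF mem(1)] assms(7) by (simp add: Qfun_def R_def)
    also have "\<dots> \<le> Qfun T r0 d l0 (R1 l0)"
    proof -
      have R1: "0 \<le> R1 l0" using assms(6) assms(15)[OF l0] by simp
      \<comment> \<open>The second argument is frozen at \<open>R1 l0\<close>, so only monotonicity
        of \<open>d\<close> in the parameter enters, and the comparison ends at \<open>l0\<close>,
        where \<open>R1 l0\<close> is a zero.\<close>
      have "d l (R1 l0) \<le> d l0 (R1 l0)"
        using mem l by (intro mono_onD[OF assms(10)[OF R1]])
      then have "2 * T * l * R1 l0 ^ 3 * d l (R1 l0) \<le> 2 * T * l0 * R1 l0 ^ 3 * d l0 (R1 l0)"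
        using l R1 T assms(8)[OF mem(1) R1] by (intro mult_mono) auto
      then show ?thesis by (simp add: Qfun_def l)
    qed
    also have "\<dots> = 0"
      using assms(14)[OF l0] by (simp add: first_two_zeros_def)
    finally show False by simp
  qed
qed

end
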